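(* Let $\mu\in\mathbb{R}$, $\sigma>0$, $\alpha\in\mathbb{R}$, $\boldsymbol{\theta}=(\mu,\sigma,\alpha)$, and let $X\sim\text{BN}(\boldsymbol{\theta})$. Then for every positive integer $n$: if $n$ is even, $$\mathbb{E}(X^n)=\sigma^n 2^{\frac{n-2}{2}}\frac{\Gamma\left(\frac{n+1}{2}\right)}{\sqrt{\pi}}\left[{}_1F_1\left(-\frac n2,\frac12;-\frac{(\mu+\alpha\sigma)^2}{2\sigma^2}\right)+{}_1F_1\left(-\frac n2,\frac12;-\frac{(\mu-\alpha\sigma)^2}{2\sigma^2}\right)\right],$$ and if $n$ is odd, $$\mathbb{E}(X^n)=\sigma^{n-1}2^{\frac{n-1}{2}}\frac{\Gamma\left(\frac n2+1\right)}{\sqrt\pi}\left[(\mu+\alpha\sigma)\,{}_1F_1\left(\frac{1-n}{2},\frac32;-\frac{(\mu+\alpha\sigma)^2}{2\sigma^2}\right)+(\mu-\alpha\sigma)\,{}_1F_1\left(\frac{1-n}{2},\frac32;-\frac{(\mu-\alpha\sigma)^2}{2\sigma^2}\right)\right].$$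
   Context: For $\boldsymbol{\theta}=(\mu,\sigma,\alpha)$, $\mu\in\mathbb{R}$, $\sigma>0$, $\alpha\in\mathbb{R}$, $X\sim\text{BN}(\boldsymbol{\theta})$ means that $X$ is a real random variable with PDF $$f(x;\boldsymbol{\theta})=\frac{1}{\sqrt{2\pi\sigma^2}}\exp\left[-\frac12\left(\frac{x-\mu}{\sigma}\right)^2-\frac{\alpha^2}{2}\right]\cosh\left[\alpha\left(\frac{x-\mu}{\sigma}\right)\right],\quad x\in\mathbb{R}.$$ $\Gamma$ is the Gamma function. ${}_1F_1$ is Kummer's confluent hypergeometric function ${}_1F_1(a,b;x)=\sum_{k=0}^\infty \frac{(a)_k}{(b)_k}\frac{x^k}{k!}$, where $(a)_0=1$ and $(a)_k=a(a+1)\cdots(a+k-1)$ for $k\ge 1$ (so that $(a)_k=\Gamma(a+k)/\Gamma(a)$ when $a$ is not a nonpositive integer). *)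

theory Defs
  imports "HOL-Probability.Probability"
begin

definition bn_density :: "real \<Rightarrow> real \<Rightarrow> real \<Rightarrow> real \<Rightarrow> real" where
  "bn_density \<mu> \<sigma> \<alpha> x =
     1 / sqrt (2 * pi * \<sigma>\<^sup>2)
       * exp (- (1 / 2) * ((x - \<mu>) / \<sigma>)\<^sup>2 - \<alpha>\<^sup>2 / 2)
       * cosh (\<alpha> * ((x - \<mu>) / \<sigma>))"

text \<open>Kummer's confluent hypergeometric function. The series converges for every real argument
  as long as the second parameter is not a nonpositive integer.\<close>

definition kummer_1F1 :: "real \<Rightarrow> real \<Rightarrow> real \<Rightarrow> real" where
  "kummer_1F1 a b x = (\<Sum>k. pochhammer a k / pochhammer b k * (x ^ k / fact k))"

end

theory Submission
  imports Defs
begin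

text \<open>The hyperbolic cosine turns the density into the equal-weight mixture of the normal densities
  with means \<open>\<mu> \<plusminus> \<alpha> * \<sigma>\<close> and common variance. The raw moments of a normal
  distribution follow from the central ones by the binomial theorem, and since the odd central moments
  vanish, the remaining terms are exactly those of the terminating Kummer series.\<close>

lemma bn_density_eq_normal_mixture:
  assumes "\<sigma> > 0"
  shows "bn_density \<mu> \<sigma> \<alpha> x =
    (normal_density (\<mu> + \<alpha> * \<sigma>) \<sigma> x + normal_density (\<mu> - \<alpha> * \<sigma>) \<sigma> x) / 2"
proof -
  define z where "z = (x - \<mu>) / \<sigma>"
  have z: "x - \<mu> = \<sigma> * z"
    using assms by (simp add: z_def)
  \<comment> \<open>Completing the square around a shift \<open>b\<close>: the instances
    \<open>\<alpha>\<close> and \<open>- \<alpha>\<close> give the two exponentials of the cosh,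
    with the same factor in front.\<close>
  have normal: "normal_density (\<mu> + b * \<sigma>) \<sigma> x =
    1 / sqrt (2 * pi * \<sigma>\<^sup>2) * (exp (- (1 / 2) * z\<^sup>2 - b\<^sup>2 / 2) * exp (b * z))" for b
  proof -
    have "x - (\<mu> + b * \<sigma>) = \<sigma> * (z - b)"
      using z by (simp add: algebra_simps)
    then have "- (x - (\<mu> + b * \<sigma>))\<^sup>2 / (2 * \<sigma>\<^sup>2) = - (1 / 2) * z\<^sup>2 - b\<^sup>2 / 2 + b * z"
      using assms by (simp add: power_mult_distrib) (simp add: power2_eq_square field_simps)
    then show ?thesis
      by (simp only: normal_density_def exp_add)
  qed
  show ?thesis
    using normal[of \<alpha>] normal[of "- \<alpha>"]
    unfolding bn_density_def z_def[symmetric] cosh_def by (simp add: algebra_simps add_divide_distrib)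
qed

text \<open>Merges the two parity cases into one formula in \<open>k\<close>, so that it applies to
  every term of a binomial expansion.\<close>

lemma normal_central_moment:
  fixes \<mu> \<sigma> :: real
  assumes "\<sigma> > 0"
  shows "has_bochner_integral lborel (\<lambda>x. normal_density \<mu> \<sigma> x * (x - \<mu>) ^ k)
    (if even k then fact k / ((2 / \<sigma>\<^sup>2) ^ (k div 2) * fact (k div 2)) else 0)"
  using normal_moment_even[OF assms, of \<mu> "k div 2"] normal_moment_odd[OF assms, of \<mu> "k div 2"]
  by (cases "even k") auto

text \<open>Expand \<open>x\<close> as \<open>\<mu> + (x - \<mu>)\<close> and integrate termwise.
  The index \<open>k\<close> counts powers of the mean, which become the powers of the Kummer
  argument.\<close>

lemma normal_raw_moment:
  fixes \<mu> \<sigma> :: real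
  assumes "\<sigma> > 0"
  shows "has_bochner_integral lborel (\<lambda>x. normal_density \<mu> \<sigma> x * x ^ n)
    (\<Sum>k\<le>n. real (n choose k) * \<mu> ^ k *
      (if even (n - k) then fact (n - k) / ((2 / \<sigma>\<^sup>2) ^ ((n - k) div 2) * fact ((n - k) div 2)) else 0))"
proof -
  have binom: "normal_density \<mu> \<sigma> x * x ^ n =
    (\<Sum>k\<le>n. (real (n choose k) * \<mu> ^ k) * (normal_density \<mu> \<sigma> x * (x - \<mu>) ^ (n - k)))" for x
    using binomial_ring[of \<mu> "x - \<mu>" n] by (simp add: sum_distrib_left ac_simps)
  show ?thesis
    unfolding binom
    by (intro has_bochner_integral_sum has_bochner_integral_mult_right normal_central_moment assms)
qed

text \<open>Used to isolate the indices with the parity of the moment order, the only ones that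
  contribute. Here the odd part has only \<open>p\<close> terms, since \<open>2 * p + 1\<close> is
  out of range.\<close>

lemma sum_atMost_even_split:
  fixes f :: "nat \<Rightarrow> 'a::comm_monoid_add"
  shows "(\<Sum>k\<le>2 * p. f k) = (\<Sum>i\<le>p. f (2 * i)) + (\<Sum>i<p. f (2 * i + 1))"
  by (induction p) (simp_all add: ac_simps)

lemma sum_atMost_odd_split:
  fixes f :: "nat \<Rightarrow> 'a::comm_monoid_add"
  shows "(\<Sum>k\<le>2 * p + 1. f k) = (\<Sum>i\<le>p. f (2 * i)) + (\<Sum>i\<le>p. f (2 * i + 1))"
  by (induction p) (simp_all add: ac_simps)

lemma pochhammer_minus_of_nat:
  assumes "i \<le> p"
  shows "pochhammer (- real p) i = (- 1) ^ i * fact p / fact (p - i)"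
  using assms
proof (induction i)
  case (Suc i)
  then have "fact (p - i) = (real p - real i) * fact (p - Suc i)"
    by (metis Suc_diff_Suc Suc_leD Suc_le_lessD fact_Suc of_nat_diff)
  \<comment> \<open>The new factor can be divided out because \<open>Suc i \<le> p\<close>.\<close>
  moreover have "real p - real i \<noteq> 0"
    using Suc.prems by simp
  ultimately show ?case
    using Suc by (simp add: pochhammer_Suc divide_simps) (simp add: algebra_simps)
qed simp

lemma pochhammer_one_half: "pochhammer (1 / 2 :: real) i = fact (2 * i) / (4 ^ i * fact i)"
  by (simp add: fact_double power_mult)

text \<open>Splitting off the first factor of the symbol at 1/2 shifts its base to 3/2; the factor
  \<open>2 * i + 2\<close> of the factorial then cancels against \<open>i + 1\<close>.\<close>

lemma pochhammer_three_halves: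
  "pochhammer (3 / 2 :: real) i = fact (2 * i + 1) / (4 ^ i * fact i)"
proof -
  have "pochhammer (1 / 2 :: real) (Suc i) = 1 / 2 * pochhammer (3 / 2) i"
    by (simp add: pochhammer_rec)
  moreover have "pochhammer (1 / 2 :: real) (Suc i) = fact (2 * i + 1) / (2 * 4 ^ i * fact i)"
    unfolding pochhammer_one_half by (simp add: divide_simps)
  ultimately show ?thesis
    by simp
qed

text \<open>The Gamma quotient for the Pochhammer symbol at 1/2, whose denominator Gamma(1/2) is
  \<open>sqrt pi\<close>.\<close>

lemma Gamma_of_nat_plus_one_half:
  "Gamma (real p + 1 / 2) / sqrt pi = fact (2 * p) / (4 ^ p * fact p)"
proof -
  have "pochhammer (1 / 2 :: real) p = Gamma (1 / 2 + real p) / Gamma (1 / 2)"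
    by (intro pochhammer_Gamma) (auto elim: nonpos_Ints_cases')
  then show ?thesis
    by (simp add: pochhammer_one_half Gamma_one_half_real add.commute)
qed

lemma Gamma_of_nat_plus_three_halves:
  "Gamma (real p + 3 / 2) / sqrt pi = fact (2 * p + 1) / (2 * 4 ^ p * fact p)"
proof -
  have "pochhammer (3 / 2 :: real) p = Gamma (3 / 2 + real p) / Gamma (3 / 2)"
    by (intro pochhammer_Gamma) (auto elim: nonpos_Ints_cases')
  moreover have "(1 / 2 :: real) \<notin> \<int>\<^sub>\<le>\<^sub>0"
    by (auto elim: nonpos_Ints_cases')
  \<comment> \<open>The functional equation at 1/2; it is the source of the extra 2 in the
    denominator.\<close>
  then have "Gamma (3 / 2 :: real) = sqrt pi / 2"
    using Gamma_plus1[of "1 / 2 :: real"] by (simp add: Gamma_one_half_real)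
  ultimately have "Gamma (real p + 3 / 2) / sqrt pi = pochhammer (3 / 2) p / 2"
    by (simp add: add.commute)
  then show ?thesis
    by (simp add: pochhammer_three_halves)
qed

text \<open>The series stops at \<open>p\<close> because later symbols contain the factor zero, and
  the sign of \<open>pochhammer (- real p) i\<close> cancels that of
  \<open>(- x) ^ i\<close>.\<close>

lemma kummer_1F1_minus_of_nat:
  "kummer_1F1 (- real p) b (- x) =
    (\<Sum>i\<le>p. fact p * x ^ i / (fact (p - i) * pochhammer b i * fact i))"
proof -
  have "kummer_1F1 (- real p) b (- x) =
    (\<Sum>i\<le>p. pochhammer (- real p) i / pochhammer b i * ((- x) ^ i / fact i))"
    unfolding kummer_1F1_def
    by (rule suminf_finite) (auto simp: pochhammer_of_nat_eq_0_iff)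
  then show ?thesis
    by (simp add: pochhammer_minus_of_nat power_minus[of x] ac_simps)
qed

lemma normal_raw_moment_even:
  fixes m \<sigma> :: real
  assumes "\<sigma> > 0"
  shows "has_bochner_integral lborel (\<lambda>x. normal_density m \<sigma> x * x ^ (2 * p))
    (\<sigma> ^ (2 * p) * 2 ^ p * (Gamma (real p + 1 / 2) / sqrt pi) *
      kummer_1F1 (- real p) (1 / 2) (- (m\<^sup>2 / (2 * \<sigma>\<^sup>2))))"
proof -
  let ?M = "\<lambda>k. real (2 * p choose k) * m ^ k * (if even (2 * p - k)
    then fact (2 * p - k) / ((2 / \<sigma>\<^sup>2) ^ ((2 * p - k) div 2) * fact ((2 * p - k) div 2)) else 0)"
  have "(\<Sum>k\<le>2 * p. ?M k) = (\<Sum>i\<le>p. ?M (2 * i))"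
    unfolding sum_atMost_even_split by (auto intro!: sum.neutral)
  also have "\<dots> = (\<Sum>i\<le>p. \<sigma> ^ (2 * p) * 2 ^ p * (Gamma (real p + 1 / 2) / sqrt pi) *
      (fact p * (m\<^sup>2 / (2 * \<sigma>\<^sup>2)) ^ i / (fact (p - i) * pochhammer (1 / 2) i * fact i)))"
  proof (rule sum.cong[OF refl])
    fix i assume "i \<in> {..p}"
    \<comment> \<open>Replacing \<open>p\<close> by \<open>i + j\<close> removes all natural
      subtraction: the central moment has order \<open>2 * j\<close>.\<close>
    then obtain j where p: "p = i + j"
      using le_Suc_ex by auto
    have d: "2 * (i + j) - 2 * i = 2 * j"
      by simp
    have c: "real (2 * (i + j) choose (2 * i)) = fact (2 * (i + j)) / (fact (2 * i) * fact (2 * j))"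
      using binomial_fact[of "2 * i" "2 * (i + j)", where 'a = real] d by simp
    have s: "(m\<^sup>2 / (2 * \<sigma>\<^sup>2)) ^ i = m ^ (2 * i) / (2 ^ i * \<sigma> ^ (2 * i))"
      "(2 / \<sigma>\<^sup>2) ^ j = 2 ^ j / \<sigma> ^ (2 * j)"
      by (simp_all add: power_divide power_mult_distrib power_mult)
    \<comment> \<open>Brings the powers of 4 from the Gamma and Pochhammer values to base 2, where
      everything reduces to \<open>2 ^ j\<close> in the denominator.\<close>
    have f: "(4::real) ^ k = 2 ^ k * 2 ^ k" for k
      by (simp flip: power_mult_distrib)
    show "?M (2 * i) = \<sigma> ^ (2 * p) * 2 ^ p * (Gamma (real p + 1 / 2) / sqrt pi) *
      (fact p * (m\<^sup>2 / (2 * \<sigma>\<^sup>2)) ^ i / (fact (p - i) * pochhammer (1 / 2) i * fact i))"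
      using assms unfolding p d c pochhammer_one_half Gamma_of_nat_plus_one_half
      by (simp add: s f power_add distrib_left ac_simps)
  qed
  finally show ?thesis
    using normal_raw_moment[OF assms, of m "2 * p"]
    by (simp add: kummer_1F1_minus_of_nat sum_distrib_left)
qed

text \<open>Only odd powers of \<open>m\<close> survive, hence the single \<open>m\<close> outside
  the series in its square. The leading 2 offsets the one in the denominator of the Gamma
  value.\<close>

lemma normal_raw_moment_odd:
  fixes m \<sigma> :: real
  assumes "\<sigma> > 0"
  shows "has_bochner_integral lborel (\<lambda>x. normal_density m \<sigma> x * x ^ (2 * p + 1))
    (2 * \<sigma> ^ (2 * p) * 2 ^ p * (Gamma (real p + 3 / 2) / sqrt pi) *
      (m * kummer_1F1 (- real p) (3 / 2) (- (m\<^sup>2 / (2 * \<sigma>\<^sup>2)))))"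
proof -
  let ?M = "\<lambda>k. real (2 * p + 1 choose k) * m ^ k * (if even (2 * p + 1 - k)
    then fact (2 * p + 1 - k) /
      ((2 / \<sigma>\<^sup>2) ^ ((2 * p + 1 - k) div 2) * fact ((2 * p + 1 - k) div 2)) else 0)"
  have "(\<Sum>k\<le>2 * p + 1. ?M k) = (\<Sum>i\<le>p. ?M (2 * i + 1))"
    unfolding sum_atMost_odd_split by (auto intro!: sum.neutral)
  also have "\<dots> = (\<Sum>i\<le>p. 2 * \<sigma> ^ (2 * p) * 2 ^ p * (Gamma (real p + 3 / 2) / sqrt pi) *
      (m * (fact p * (m\<^sup>2 / (2 * \<sigma>\<^sup>2)) ^ i / (fact (p - i) * pochhammer (3 / 2) i * fact i))))"
  proof (rule sum.cong[OF refl])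
    fix i assume "i \<in> {..p}"
    then obtain j where p: "p = i + j"
      using le_Suc_ex by auto
    have d: "2 * (i + j) + 1 - (2 * i + 1) = 2 * j"
      by simp
    have c: "real (2 * (i + j) + 1 choose (2 * i + 1)) =
      fact (2 * (i + j) + 1) / (fact (2 * i + 1) * fact (2 * j))"
      using binomial_fact[of "2 * i + 1" "2 * (i + j) + 1", where 'a = real] unfolding d by simp
    have s: "(m\<^sup>2 / (2 * \<sigma>\<^sup>2)) ^ i = m ^ (2 * i) / (2 ^ i * \<sigma> ^ (2 * i))"
      "(2 / \<sigma>\<^sup>2) ^ j = 2 ^ j / \<sigma> ^ (2 * j)"
      by (simp_all add: power_divide power_mult_distrib power_mult)
    have f: "(4::real) ^ k = 2 ^ k * 2 ^ k" for k
      by (simp flip: power_mult_distrib)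
    show "?M (2 * i + 1) = 2 * \<sigma> ^ (2 * p) * 2 ^ p * (Gamma (real p + 3 / 2) / sqrt pi) *
      (m * (fact p * (m\<^sup>2 / (2 * \<sigma>\<^sup>2)) ^ i / (fact (p - i) * pochhammer (3 / 2) i * fact i)))"
      using assms unfolding p d c pochhammer_three_halves Gamma_of_nat_plus_three_halves
      \<comment> \<open>The odd factorials must stay folded to cancel as wholes.\<close>
      by (simp add: s f power_add distrib_left ac_simps del: fact_Suc)
  qed
  finally show ?thesis
    using normal_raw_moment[OF assms, of m "2 * p + 1"]
    by (simp add: kummer_1F1_minus_of_nat sum_distrib_left)
qed

text \<open>Moves the integral from \<open>M\<close> to the line, where the mixture averages the two
  normal moments; \<open>has_bochner_integral\<close> carries integrability and value
  together.\<close>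

lemma bn_moment:
  assumes "\<sigma> > 0" and X: "distributed M lborel X (\<lambda>x. ennreal (bn_density \<mu> \<sigma> \<alpha> x))"
    and A: "has_bochner_integral lborel (\<lambda>x. normal_density (\<mu> + \<alpha> * \<sigma>) \<sigma> x * x ^ n) a"
    and B: "has_bochner_integral lborel (\<lambda>x. normal_density (\<mu> - \<alpha> * \<sigma>) \<sigma> x * x ^ n) b"
  shows "has_bochner_integral M (\<lambda>\<omega>. X \<omega> ^ n) ((a + b) / 2)"
proof -
  have nonneg: "0 \<le> bn_density \<mu> \<sigma> \<alpha> x" for x
    by (simp add: bn_density_eq_normal_mixture[OF \<open>\<sigma> > 0\<close>])
  have eq: "bn_density \<mu> \<sigma> \<alpha> x * x ^ n = (normal_density (\<mu> + \<alpha> * \<sigma>) \<sigma> x * x ^ n +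
      normal_density (\<mu> - \<alpha> * \<sigma>) \<sigma> x * x ^ n) / 2" for x
    by (simp add: bn_density_eq_normal_mixture[OF \<open>\<sigma> > 0\<close>] algebra_simps)
  have "has_bochner_integral lborel (\<lambda>x. bn_density \<mu> \<sigma> \<alpha> x * x ^ n) ((a + b) / 2)"
    unfolding eq by (intro has_bochner_integral_divide has_bochner_integral_add A B)
  then show ?thesis
    using distributed_integrable[OF X, of "\<lambda>x. x ^ n"] distributed_integral[OF X, of "\<lambda>x. x ^ n"]
    by (simp add: has_bochner_integral_iff nonneg)
qed

theorem proposition4p2:
  fixes \<mu> \<sigma> \<alpha> :: real and M :: "'a measure" and X :: "'a \<Rightarrow> real" and n :: nat
  assumes "prob_space M"
    and "\<sigma> > 0"
    and "distributed M lborel X (\<lambda>x. ennreal (bn_density \<mu> \<sigma> \<alpha> x))"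
    and "n > 0"
  shows "integrable M (\<lambda>\<omega>. X \<omega> ^ n) \<and>
    (even n \<longrightarrow>
       prob_space.expectation M (\<lambda>\<omega>. X \<omega> ^ n) =
         \<sigma> ^ n * 2 powr ((real n - 2) / 2) * (Gamma ((real n + 1) / 2) / sqrt pi) *
         (kummer_1F1 (- (real n / 2)) (1 / 2) (- ((\<mu> + \<alpha> * \<sigma>)\<^sup>2 / (2 * \<sigma>\<^sup>2))) +
          kummer_1F1 (- (real n / 2)) (1 / 2) (- ((\<mu> - \<alpha> * \<sigma>)\<^sup>2 / (2 * \<sigma>\<^sup>2))))) \<and>
    (odd n \<longrightarrow>
       prob_space.expectation M (\<lambda>\<omega>. X \<omega> ^ n) =
         \<sigma> ^ (n - 1) * 2 powr ((real n - 1) / 2) * (Gamma (real n / 2 + 1) / sqrt pi) *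
         ((\<mu> + \<alpha> * \<sigma>) *
            kummer_1F1 ((1 - real n) / 2) (3 / 2) (- ((\<mu> + \<alpha> * \<sigma>)\<^sup>2 / (2 * \<sigma>\<^sup>2))) +
          (\<mu> - \<alpha> * \<sigma>) *
            kummer_1F1 ((1 - real n) / 2) (3 / 2) (- ((\<mu> - \<alpha> * \<sigma>)\<^sup>2 / (2 * \<sigma>\<^sup>2)))))"
proof (cases "even n")
  case True
  then obtain p where n: "n = 2 * p"
    by blast
  \<comment> \<open>The division by 2 is the mixture weight.\<close>
  have two: "2 powr ((real n - 2) / 2) = 2 ^ p / 2"
    by (simp add: n diff_divide_distrib powr_diff powr_realpow)
  have half: "(real n + 1) / 2 = real p + 1 / 2" "real n / 2 = real p"
    by (simp_all add: n field_simps)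
  show ?thesis
    unfolding two half
    using bn_moment[OF assms(2,3) normal_raw_moment_even[OF assms(2), where p = p, folded n]
        normal_raw_moment_even[OF assms(2), where p = p, folded n]] True
    by (simp add: has_bochner_integral_iff algebra_simps)
next
  case False
  then obtain p where n: "n = 2 * p + 1"
    by (elim oddE)
  \<comment> \<open>No halving remains here: the mixture weight cancels the leading 2 of the odd
    normal moment.\<close>
  have two: "2 powr ((real n - 1) / 2) = 2 ^ p"
    by (simp add: n powr_realpow)
  have half: "real n / 2 + 1 = real p + 3 / 2" "(1 - real n) / 2 = - real p" "n - 1 = 2 * p"
    by (simp_all add: n field_simps)
  show ?thesis
    unfolding two half
    using bn_moment[OF assms(2,3) normal_raw_moment_odd[OF assms(2), where p = p, folded n]
        normal_raw_moment_odd[OF assms(2), where p = p, folded n]] False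
    by (simp add: has_bochner_integral_iff distrib_left add_divide_distrib)
qed

end
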